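(* Let $\lambda>0$. The risk-constrained Kelly gambling problem $$\begin{array}{ll}\text{maximize} & \mathbf{E}\log(r^Tb)\\ \text{subject to} & \mathbf 1^Tb=1,\quad b\ge 0,\\ & \mathbf{E}(r^Tb)^{-\lambda}\le 1,\end{array}$$ with variable $b\in\mathbf{R}^n$, is a convex optimization problem. That is, on the set $\{b\in\mathbf{R}^n\mid \mathbf 1^Tb=1,\ b\ge 0\}$ the objective $b\mapsto\mathbf{E}\log(r^Tb)$ is concave and the constraint function $b\mapsto\mathbf{E}(r^Tb)^{-\lambda}$ is convex (so the feasible set is convex).
   Context: $r$ is a random vector in $\mathbf{R}^n$ with nonnegative entries, $\mathbf{E}\,r_i<\infty$ for $i=1,\dots,n$, and $r_n=1$ almost surely. $\mathbf 1$ is the all-ones vector and $b\ge0$ is entrywise. Conventions: $\log 0=-\infty$ and $0^{-\lambda}=+\infty$; thus $\mathbf{E}\log(r^Tb)\in[-\infty,\infty)$ and $\mathbf{E}(r^Tb)^{-\lambda}\in[0,\infty]$, and concavity/convexity are meant in the extended-real-valued sense. *)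

theory Defs
  imports "HOL-Probability.Probability"
begin

text \<open>Extended-real logarithm and negative power with the conventions
  \<open>log 0 = -\<infinity>\<close> and \<open>0^(-l) = \<infinity>\<close>. The values at negative arguments are immaterial:
  they are only used at almost surely nonnegative random variables.\<close>

definition elog :: "real \<Rightarrow> ereal" where
  "elog x = (if x > 0 then ereal (ln x) else -\<infinity>)"

definition eneg_powr :: "real \<Rightarrow> real \<Rightarrow> ereal" where
  "eneg_powr l x = (if x > 0 then ereal (x powr (- l)) else \<infinity>)"

text \<open>Expectation of an extended-real random variable, as the integral of the positive part minus
  the integral of the negative part; \<open>e2ennreal\<close> truncates at 0. It is meaningful when one of the
  two integrals is finite (otherwise the value is the junk value \<open>\<infinity> - \<infinity> = \<infinity>\<close> of type
  \<open>ereal\<close>).\<close>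

definition eexpectation :: "'a measure \<Rightarrow> ('a \<Rightarrow> ereal) \<Rightarrow> ereal" where
  "eexpectation M X =
     enn2ereal (\<integral>\<^sup>+ \<omega>. e2ennreal (X \<omega>) \<partial>M) - enn2ereal (\<integral>\<^sup>+ \<omega>. e2ennreal (- X \<omega>) \<partial>M)"

text \<open>Convexity of functions into \<open>(-\<infinity>, \<infinity>]\<close> and concavity of functions into \<open>[-\<infinity>, \<infinity>)\<close>,
  following the library's \<open>convex_on\<close>. Excluding one infinite value ensures that
  \<open>\<infinity> - \<infinity>\<close> never occurs; note \<open>0 * \<infinity> = 0\<close> in \<open>ereal\<close>.\<close>

definition econvex_on :: "'v::real_vector set \<Rightarrow> ('v \<Rightarrow> ereal) \<Rightarrow> bool" where
  "econvex_on S f \<longleftrightarrow> convex S \<and> (\<forall>x\<in>S. f x \<noteq> -\<infinity>) \<and>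
    (\<forall>x\<in>S. \<forall>y\<in>S. \<forall>u\<ge>0. \<forall>v\<ge>0. u + v = 1 \<longrightarrow>
       f (u *\<^sub>R x + v *\<^sub>R y) \<le> ereal u * f x + ereal v * f y)"

definition econcave_on :: "'v::real_vector set \<Rightarrow> ('v \<Rightarrow> ereal) \<Rightarrow> bool" where
  "econcave_on S f \<longleftrightarrow> econvex_on S (\<lambda>x. - f x)"

definition bets :: "(real ^ 'n) set" where
  "bets = {b. (\<Sum>i\<in>UNIV. b $ i) = 1 \<and> (\<forall>i. b $ i \<ge> 0)}"

definition growth_rate :: "'a measure \<Rightarrow> ('a \<Rightarrow> real ^ 'n) \<Rightarrow> real ^ 'n \<Rightarrow> ereal" where
  "growth_rate M r b = eexpectation M (\<lambda>\<omega>. elog (r \<omega> \<bullet> b))"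

definition risk :: "'a measure \<Rightarrow> ('a \<Rightarrow> real ^ 'n) \<Rightarrow> real \<Rightarrow> real ^ 'n \<Rightarrow> ereal" where
  "risk M r l b = eexpectation M (\<lambda>\<omega>. eneg_powr l (r \<omega> \<bullet> b))"

end

theory Submission
  imports Defs
begin

text \<open>
  Both integrands are convex functions of the payoff \<open>z = r \<bullet> b\<close> with value \<open>\<infinity>\<close> for \<open>z \<le> 0\<close>, and
  \<open>z\<close> is linear in \<open>b\<close>. For the power function this passes through the expectation at once. For
  \<open>- ln z\<close>, which changes sign, one integrates the nonnegative convex function \<open>z - ln z\<close> and
  then subtracts \<open>\<integral> r \<bullet> b\<close>, which is finite and linear in \<open>b\<close>.
\<close>

text \<open>The values lie in \<open>ennreal\<close> so that \<open>nn_integral\<close> applies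
  whether or not the integral is finite. The value \<open>\<top>\<close> off the positive axis
  encodes both conventions, \<open>- log 0 = \<infinity>\<close> and
  \<open>0^(-l) = \<infinity>\<close>.\<close>

definition top_extend :: "(real \<Rightarrow> real) \<Rightarrow> real \<Rightarrow> ennreal" where
  "top_extend g z = (if z > 0 then ennreal (g z) else \<top>)"

lemma top_extend_convex:
  assumes g: "convex_on {0<..} g" and nonneg: "\<And>z. z > 0 \<Longrightarrow> g z \<ge> 0"
    and uv: "u \<ge> 0" "v \<ge> 0" "u + v = 1"
  shows "top_extend g (u * a + v * b) \<le> ennreal u * top_extend g a + ennreal v * top_extend g b"
proof -
  \<comment> \<open>Zero weights are set apart because \<open>0 * \<top> = 0\<close>. When both
    weights are positive, a single nonpositive point already makes the right-hand side
    \<open>\<top>\<close>.\<close>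
  consider "u = 0" "v = 1" | "u = 1" "v = 0" | "u > 0" "v > 0"
    using uv by force
  then show ?thesis
  proof cases
    case 3
    show ?thesis
    proof (cases "a > 0 \<and> b > 0")
      case True
      then have "u * a + v * b > 0"
        using 3 by (simp add: add_pos_pos)
      moreover have "g (u * a + v * b) \<le> u * g a + v * g b"
        using g True uv by (auto simp: convex_on_def)
      ultimately show ?thesis
        using True 3 nonneg
        by (simp add: top_extend_def ennreal_leI flip: ennreal_mult ennreal_plus)
    next
      case False
      then have "ennreal u * top_extend g a + ennreal v * top_extend g b = \<top>"
        using 3 by (auto simp: top_extend_def ennreal_mult_top)
      then show ?thesis by (simp only: top_greatest)
    qed
  qed simp_all
qed

lemma top_extend_measurable:
  assumes [measurable]: "g \<in> borel_measurable borel"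
  shows "top_extend g \<in> borel_measurable borel"
  unfolding top_extend_def by measurable

text \<open>The pointwise inequality at the payoffs is integrated. In \<open>ennreal\<close>,
  additivity of the integral asks only for measurability, so infinite integrals need no separate
  case.\<close>

lemma nn_integral_top_extend_convex:
  fixes r :: "'a \<Rightarrow> 'b::euclidean_space"
  assumes [measurable]: "r \<in> borel_measurable M" "g \<in> borel_measurable borel"
    and g: "convex_on {0<..} g" "\<And>z. z > 0 \<Longrightarrow> g z \<ge> 0"
    and uv: "u \<ge> 0" "v \<ge> 0" "u + v = 1"
  shows "(\<integral>\<^sup>+ \<omega>. top_extend g (r \<omega> \<bullet> (u *\<^sub>R x + v *\<^sub>R y)) \<partial>M)
    \<le> ennreal u * (\<integral>\<^sup>+ \<omega>. top_extend g (r \<omega> \<bullet> x) \<partial>M)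
      + ennreal v * (\<integral>\<^sup>+ \<omega>. top_extend g (r \<omega> \<bullet> y) \<partial>M)"
proof -
  note [measurable] = top_extend_measurable
  have "(\<integral>\<^sup>+ \<omega>. top_extend g (r \<omega> \<bullet> (u *\<^sub>R x + v *\<^sub>R y)) \<partial>M)
    \<le> (\<integral>\<^sup>+ \<omega>. ennreal u * top_extend g (r \<omega> \<bullet> x) + ennreal v * top_extend g (r \<omega> \<bullet> y) \<partial>M)"
    using top_extend_convex[OF g uv]
    by (intro nn_integral_mono) (simp add: inner_add_right)
  also have "\<dots> = ennreal u * (\<integral>\<^sup>+ \<omega>. top_extend g (r \<omega> \<bullet> x) \<partial>M)
      + ennreal v * (\<integral>\<^sup>+ \<omega>. top_extend g (r \<omega> \<bullet> y) \<partial>M)"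
    by (simp add: nn_integral_add nn_integral_cmult)
  finally show ?thesis .
qed

text \<open>Carries inequalities between integrals from \<open>ennreal\<close> to
  \<open>ereal\<close>, where convexity is defined.\<close>

lemma enn2ereal_convex_combination:
  assumes "A \<le> ennreal u * B + ennreal v * C" "u \<ge> 0" "v \<ge> 0"
  shows "enn2ereal A \<le> ereal u * enn2ereal B + ereal v * enn2ereal C"
proof -
  have "enn2ereal A \<le> enn2ereal (ennreal u * B + ennreal v * C)"
    using assms(1) by (simp add: less_eq_ennreal.rep_eq)
  then show ?thesis
    using assms by (simp add: plus_ennreal.rep_eq times_ennreal.rep_eq enn2ereal_ennreal)
qed

lemma convex_on_powr_minus:
  assumes "l > 0"
  shows "convex_on {0<..} (\<lambda>z::real. z powr (- l))"
proof (rule f''_ge0_imp_convex)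
  show "convex {0::real<..}" by simp
  fix z :: real assume "z \<in> {0<..}"
  then have z: "z > 0" by simp
  show "DERIV (\<lambda>z. z powr (- l)) z :> - l * z powr (- l - 1)"
    using z by (auto intro!: derivative_eq_intros)
  show "DERIV (\<lambda>z. - l * z powr (- l - 1)) z :> l * (l + 1) * z powr (- l - 1 - 1)"
    using z by (auto intro!: derivative_eq_intros simp: algebra_simps)
  show "l * (l + 1) * z powr (- l - 1 - 1) \<ge> 0"
    using assms by simp
qed

lemma convex_on_ident_minus_ln: "convex_on {0<..} (\<lambda>z::real. z - ln z)"
  by (intro convex_on_diff ln_concave) (simp add: convex_on_ident)

lemma convex_bets: "convex bets"
  unfolding convex_def bets_def
  by (auto simp: sum.distrib simp flip: sum_distrib_left)

text \<open>Since \<open>eneg_powr\<close> is nonnegative, the subtracted integral in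
  \<open>eexpectation\<close> is zero.\<close>

lemma risk_eq: "risk M r l b = enn2ereal (\<integral>\<^sup>+ \<omega>. top_extend (\<lambda>z. z powr (- l)) (r \<omega> \<bullet> b) \<partial>M)"
proof -
  have pos: "e2ennreal (eneg_powr l z) = top_extend (\<lambda>z. z powr (- l)) z" for z
    by (simp add: eneg_powr_def top_extend_def)
  have neg: "e2ennreal (- eneg_powr l z) = 0" for z
    by (intro e2ennreal_neg) (simp add: eneg_powr_def)
  show ?thesis
    by (simp add: risk_def eexpectation_def pos neg zero_ennreal.rep_eq)
qed

text \<open>Adding the payoff \<open>z\<close> to \<open>- ln z\<close> gives an integrand whose
  integral always exists in \<open>[0, \<infinity>]\<close>. The added mean can be subtracted again
  because it is finite, so the identity survives a growth rate of
  \<open>-\<infinity>\<close>.\<close>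

lemma growth_rate_eq:
  fixes r :: "'a \<Rightarrow> real ^ 'n"
  assumes [measurable]: "r \<in> borel_measurable M"
    and int: "integrable M (\<lambda>\<omega>. r \<omega> \<bullet> b)" and nonneg: "AE \<omega> in M. r \<omega> \<bullet> b \<ge> 0"
  shows "- growth_rate M r b =
    enn2ereal (\<integral>\<^sup>+ \<omega>. top_extend (\<lambda>z. z - ln z) (r \<omega> \<bullet> b) \<partial>M) - ereal (\<integral>\<omega>. r \<omega> \<bullet> b \<partial>M)"
proof -
  note [measurable] = top_extend_measurable
  have elog_meas [measurable]: "elog \<in> borel_measurable borel"
    unfolding elog_def by measurable
  define P where "P = (\<integral>\<^sup>+ \<omega>. e2ennreal (elog (r \<omega> \<bullet> b)) \<partial>M)"
  define N where "N = (\<integral>\<^sup>+ \<omega>. e2ennreal (- elog (r \<omega> \<bullet> b)) \<partial>M)"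
  define Q where "Q = (\<integral>\<^sup>+ \<omega>. top_extend (\<lambda>z. z - ln z) (r \<omega> \<bullet> b) \<partial>M)"
  define m where "m = (\<integral>\<omega>. r \<omega> \<bullet> b \<partial>M)"
  \<comment> \<open>\<open>ennreal\<close> truncates negative values to 0; almost sure nonnegativity
    makes this the true mean.\<close>
  have m: "(\<integral>\<^sup>+ \<omega>. ennreal (r \<omega> \<bullet> b) \<partial>M) = ennreal m"
    unfolding m_def by (rule nn_integral_eq_integral[OF int nonneg])
  have m0: "m \<ge> 0"
    unfolding m_def by (rule integral_nonneg_AE[OF nonneg])
  \<comment> \<open>The bound \<open>ln z \<le> z\<close> makes the positive part of the logarithm
    integrable, which rules out \<open>\<infinity> - \<infinity>\<close> in the growth rate.\<close>
  have "e2ennreal (elog z) \<le> ennreal z" for z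
    by (cases "z > 0") (auto simp: elog_def e2ennreal_neg ln_bound intro!: ennreal_leI)
  then have "P \<le> ennreal m"
    unfolding P_def m[symmetric] by (intro nn_integral_mono)
  then obtain p where p: "P = ennreal p" "p \<ge> 0"
    by (cases P) (auto simp: top_unique)
  \<comment> \<open>The equation \<open>- ln z + z = z - ln z\<close> with the positive part of
    \<open>ln z\<close> added to both sides, so that every term is nonnegative. For
    \<open>z \<le> 0\<close> both sides are \<open>\<top>\<close>.\<close>
  have split: "e2ennreal (- elog z) + ennreal z = top_extend (\<lambda>z. z - ln z) z + e2ennreal (elog z)"
    for z
  proof (cases "z > 0")
    case True
    then have "ln z \<le> z" by (rule ln_bound)
    with True show ?thesis
      by (cases "ln z \<ge> 0")
        (simp_all add: elog_def top_extend_def ennreal_neg flip: ennreal_plus)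
  qed (simp add: elog_def top_extend_def)
  have "N + ennreal m = Q + P"
    unfolding N_def Q_def P_def m[symmetric]
    by (subst (1 2) nn_integral_add[symmetric]) (auto simp: split)
  then have "enn2ereal N + ereal m = enn2ereal Q + ereal p"
    using p m0 by (metis enn2ereal_ennreal plus_ennreal.rep_eq)
  \<comment> \<open>Only \<open>N\<close> and \<open>Q\<close> can be infinite, and since
    \<open>m\<close> and \<open>p\<close> are real they are so together.\<close>
  then have "- (ereal p - enn2ereal N) = enn2ereal Q - ereal m"
    by (cases "enn2ereal N"; cases "enn2ereal Q") auto
  then show ?thesis
    using p unfolding growth_rate_def eexpectation_def P_def[symmetric] N_def[symmetric]
      Q_def[symmetric] m_def[symmetric]
    by (simp add: enn2ereal_ennreal)
qed

lemma econvex_on_risk: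
  assumes "r \<in> borel_measurable M" and "l > 0"
  shows "econvex_on bets (risk M r l)"
  unfolding econvex_on_def risk_eq
proof (intro conjI ballI allI impI)
  fix x y u v assume uv: "(u::real) \<ge> 0" "v \<ge> 0" "u + v = 1"
  show "enn2ereal (\<integral>\<^sup>+ \<omega>. top_extend (\<lambda>z. z powr (- l)) (r \<omega> \<bullet> (u *\<^sub>R x + v *\<^sub>R y)) \<partial>M)
    \<le> ereal u * enn2ereal (\<integral>\<^sup>+ \<omega>. top_extend (\<lambda>z. z powr (- l)) (r \<omega> \<bullet> x) \<partial>M)
      + ereal v * enn2ereal (\<integral>\<^sup>+ \<omega>. top_extend (\<lambda>z. z powr (- l)) (r \<omega> \<bullet> y) \<partial>M)"
    using assms uv
    by (intro enn2ereal_convex_combination nn_integral_top_extend_convex convex_on_powr_minus) auto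
qed (auto simp: convex_bets)

text \<open>The negated growth rate is a convex function into \<open>[0, \<infinity>]\<close> minus
  a linear functional, finite by integrability of the entries of \<open>r\<close>. Nonnegativity of
  \<open>r\<close> and of the bets gives the nonnegative payoff that \<open>growth_rate_eq\<close>
  asks for.\<close>

lemma econcave_on_growth_rate:
  fixes r :: "'a \<Rightarrow> real ^ 'n"
  assumes meas: "r \<in> borel_measurable M"
    and nonneg: "AE \<omega> in M. \<forall>i. r \<omega> $ i \<ge> 0"
    and int: "\<And>i. integrable M (\<lambda>\<omega>. r \<omega> $ i)"
  shows "econcave_on bets (growth_rate M r)"
proof -
  define Q where "Q b = enn2ereal (\<integral>\<^sup>+ \<omega>. top_extend (\<lambda>z. z - ln z) (r \<omega> \<bullet> b) \<partial>M)" for b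
  define m where "m b = (\<integral>\<omega>. r \<omega> \<bullet> b \<partial>M)" for b
  have int': "integrable M (\<lambda>\<omega>. r \<omega> \<bullet> b)" for b
    unfolding inner_vec_def using int by simp
  have eq: "- growth_rate M r b = Q b - ereal (m b)" if "b \<in> bets" for b
    unfolding Q_def m_def
  proof (rule growth_rate_eq[OF meas int'])
    show "AE \<omega> in M. r \<omega> \<bullet> b \<ge> 0"
      using nonneg
      by eventually_elim (use that in \<open>auto simp: inner_vec_def bets_def intro!: sum_nonneg\<close>)
  qed
  have Q_nonneg: "Q b \<ge> 0" for b
    by (simp add: Q_def)
  show ?thesis
    unfolding econcave_on_def econvex_on_def
  proof (intro conjI ballI allI impI)
    fix x :: "real ^ 'n" assume "x \<in> bets"
    then show "- growth_rate M r x \<noteq> - \<infinity>"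
      using eq Q_nonneg[of x] by (cases "Q x") auto
  next
    fix x y :: "real ^ 'n" and u v :: real
    assume xy: "x \<in> bets" "y \<in> bets" and uv: "u \<ge> 0" "v \<ge> 0" "u + v = 1"
    have z: "u *\<^sub>R x + v *\<^sub>R y \<in> bets"
      using convex_bets xy uv by (auto simp: convex_def)
    have "Q (u *\<^sub>R x + v *\<^sub>R y) \<le> ereal u * Q x + ereal v * Q y"
      unfolding Q_def using meas uv convex_on_ident_minus_ln
      by (intro enn2ereal_convex_combination nn_integral_top_extend_convex)
        (auto simp: ln_bound)
    moreover have "m (u *\<^sub>R x + v *\<^sub>R y) = u * m x + v * m y"
      using int' by (simp add: m_def inner_add_right)
    \<comment> \<open>Distributivity can fail in \<open>ereal\<close>; here \<open>c\<close> is real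
      and \<open>q\<close> is nonnegative, and for \<open>a = 0\<close>,
      \<open>q = \<infinity>\<close> both sides are 0.\<close>
    moreover have "ereal a * (q - ereal c) = ereal a * q - ereal (a * c)"
      if "a \<ge> 0" "q \<ge> 0" for a c q
      using that by (cases q; cases "a = 0") (auto simp: algebra_simps)
    ultimately show "- growth_rate M r (u *\<^sub>R x + v *\<^sub>R y)
        \<le> ereal u * - growth_rate M r x + ereal v * - growth_rate M r y"
      unfolding eq[OF xy(1)] eq[OF xy(2)] eq[OF z] using uv Q_nonneg
      by (cases "ereal u * Q x"; cases "ereal v * Q y"; cases "Q (u *\<^sub>R x + v *\<^sub>R y)") auto
  qed (rule convex_bets)
qed

text \<open>A convex combination of two values at most \<open>c\<close> is at most \<open>c\<close>.
  Applied to \<open>risk\<close> with \<open>c = 1\<close>, this gives convexity of the feasible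
  set.\<close>

lemma econvex_on_imp_convex_sublevel:
  assumes f: "econvex_on S f"
  shows "convex {x \<in> S. f x \<le> ereal c}"
proof (rule convexI)
  fix x y u v
  assume xy: "x \<in> {x \<in> S. f x \<le> ereal c}" "y \<in> {x \<in> S. f x \<le> ereal c}"
    and uv: "(u::real) \<ge> 0" "v \<ge> 0" "u + v = 1"
  have "f (u *\<^sub>R x + v *\<^sub>R y) \<le> ereal u * f x + ereal v * f y"
    using f xy uv by (auto simp: econvex_on_def)
  also have "\<dots> \<le> ereal u * ereal c + ereal v * ereal c"
    using xy uv by (intro add_mono ereal_mult_left_mono) auto
  also have "\<dots> = ereal c"
    using uv by (simp flip: distrib_right)
  finally show "u *\<^sub>R x + v *\<^sub>R y \<in> {x \<in> S. f x \<le> ereal c}"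
    using f xy uv by (auto simp: econvex_on_def convex_def)
qed

theorem mainTheorem2:
  fixes M :: "'a measure" and r :: "'a \<Rightarrow> real ^ 'n" and k :: 'n and l :: real
  assumes "prob_space M"
    and "r \<in> borel_measurable M"
    and "AE \<omega> in M. \<forall>i. r \<omega> $ i \<ge> 0"
    and "\<And>i. integrable M (\<lambda>\<omega>. r \<omega> $ i)"
    and "AE \<omega> in M. r \<omega> $ k = 1"
    and "l > 0"
  shows "econcave_on bets (growth_rate M r)
       \<and> econvex_on bets (risk M r l)
       \<and> convex {b \<in> bets. risk M r l b \<le> 1}"
  using econcave_on_growth_rate[OF assms(2-4)] econvex_on_risk[OF assms(2,6)]
    econvex_on_imp_convex_sublevel[OF econvex_on_risk[OF assms(2,6)], of 1]
  by (simp add: one_ereal_def)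

end
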